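(* Let $(X,\rho)$ be a compact metric space, let $d\ge 1$, let $T:\mathbb{Z}^d\times X\to X$ be a continuous $\mathbb{Z}^d$-action on $X$, let $(Sub_X,\hat{T})$ be the induced action on the hyperspace $Sub_X$, and let $k\in\{1,\dots,2^d\}$. If $(X,T)$ is $k$-type Li--Yorke chaotic, then $(Sub_X,\hat{T})$ is $k$-type Li--Yorke chaotic.
   Context: A $\mathbb{Z}^d$-action on $X$ is a continuous map $T:\mathbb{Z}^d\times X\to X$, written $T^n(x)=T(n,x)$, with $T^0(x)=x$ and $T^{n+m}(x)=T^n(T^m(x))$ for all $x\in X$, $n,m\in\mathbb{Z}^d$. For $k\in\{1,\dots,2^d\}$ let $k^b=(k^b_1,\dots,k^b_d)\in\{0,1\}^d$ be defined by $k-1=\sum_{i=1}^d k^b_i 2^{i-1}$. For $x,y\in\mathbb{Z}^d$, write $x>^k y$ if $(-1)^{k^b_i}x_i>(-1)^{k^b_i}y_i$ for all $i=1,\dots,d$. The hyperspace $Sub_X$ is the set of all non-empty closed (equivalently, non-empty compact) subsets of $X$, endowed with the Hausdorff metric $H(A,B)=\max\{\sup_{a\in A}\rho(a,B),\sup_{b\in B}\rho(b,A)\}$, where $\rho(x,S)=\inf_{s\in S}\rho(x,s)$; it is a compact metric space. The induced $\mathbb{Z}^d$-action $\hat{T}$ on $Sub_X$ is $\hat{T}^m(A)=T^m(A)=\{T^m(x):x\in A\}$. For $\epsilon>0$ let $V_\epsilon=\{(x,y)\in X\times X:\rho(x,y)<\epsilon\}$ and $\overline{V_\epsilon}=\{(x,y)\in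 X\times X:\rho(x,y)\le\epsilon\}$. The set of $k$-type proximal pairs is $k\text{-}Prox(T)=\bigcap_{\epsilon>0}\bigcup_{n>^k 0}(T^{-n}\times T^{-n})(V_\epsilon)$; that is, $(x,y)\in k\text{-}Prox(T)$ iff for every $\epsilon>0$ there is $n>^k0$ with $\rho(T^n x,T^n y)<\epsilon$. The set of $k$-type asymptotic pairs is $k\text{-}Asym(T)=\bigcap_{\epsilon>0}\bigcup_{n>^k0}(T^{-n}\times T^{-n})\bigl(\bigcap_{m>^k0}(T^{-m}\times T^{-m})(\overline{V_\epsilon})\bigr)$; that is, $(x,y)\in k\text{-}Asym(T)$ iff for every $\epsilon>0$ there is $n>^k0$ such that $\rho(T^{n+m}x,T^{n+m}y)\le\epsilon$ for all $m>^k0$. A pair $(x,y)$ is a $k$-type Li--Yorke pair if $(x,y)\in k\text{-}Prox(T)\setminus k\text{-}Asym(T)$. A subset $S\subseteq X$ is $k$-scrambled if any two distinct points of $S$ form a $k$-type Li--Yorke pair. $(X,T)$ is $k$-type Li--Yorke chaotic if $X$ contains an uncountable $k$-scrambled set. The notions for $(Sub_X,\hat{T})$ are obtained by replacing $X,T,\rho$ with $Sub_X,\hat{T},H$. *)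

theory Defs
  imports "HOL-Analysis.Analysis" "HOL-Library.Function_Algebras"
begin

text \<open>
  The group \<open>\<int>\<^sup>d\<close> consists of the integer sequences supported on the coordinates \<open>1, \<dots>, d\<close>, with
  the pointwise operations \<open>0\<close>, \<open>+\<close>, \<open>-\<close> on functions.
\<close>

definition Zd :: "nat \<Rightarrow> (nat \<Rightarrow> int) set" where
  "Zd d = {n. \<forall>i. i \<notin> {1..d} \<longrightarrow> n i = 0}"

text \<open>
  The \<open>i\<close>-th binary digit \<open>k\<^sup>b\<^sub>i\<close> of \<open>k - 1\<close>, counted from \<open>i = 1\<close>; meant for \<open>k \<ge> 1\<close> and \<open>i \<ge> 1\<close>.
  The two lemmas below show that it is the digit sequence determined by the binary expansion.
\<close>

definition kbit :: "nat \<Rightarrow> nat \<Rightarrow> nat" where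
  "kbit k i = (k - 1) div 2 ^ (i - 1) mod 2"

lemma kbit_01: "kbit k i \<in> {0, 1}"
  by (auto simp: kbit_def)

lemma digit_expansion_mod: "(\<Sum>i=1..d. (n div 2 ^ (i - 1) mod 2) * 2 ^ (i - 1)) = n mod 2 ^ d"
  for n :: nat
proof (induction d)
  case 0
  show ?case by simp
next
  case (Suc d)
  have "n mod 2 ^ Suc d = n mod (2 ^ d * 2)"
    by (simp add: mult.commute)
  also have "\<dots> = 2 ^ d * (n div 2 ^ d mod 2) + n mod 2 ^ d"
    by (rule mod_mult2_eq)
  finally show ?case
    using Suc.IH by (simp add: mult.commute)
qed

lemma kbit_expansion:
  assumes "k \<in> {1..2 ^ d}"
  shows "k - 1 = (\<Sum>i=1..d. kbit k i * 2 ^ (i - 1))"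
proof -
  have "k - 1 < 2 ^ d"
    using assms by auto
  then show ?thesis
    by (simp only: kbit_def digit_expansion_mod) simp
qed

lemma digits_unique:
  fixes b c :: "nat \<Rightarrow> nat"
  assumes "\<And>i. i \<in> {1..d} \<Longrightarrow> b i \<in> {0, 1}" "\<And>i. i \<in> {1..d} \<Longrightarrow> c i \<in> {0, 1}"
    and "(\<Sum>i=1..d. b i * 2 ^ (i - 1)) = (\<Sum>i=1..d. c i * 2 ^ (i - 1))"
  shows "\<forall>i\<in>{1..d}. b i = c i"
  using assms
proof (induction d)
  case 0
  then show ?case by simp
next
  case (Suc d)
  have bound: "(\<Sum>i=1..d. f i * 2 ^ (i - 1)) < 2 ^ d"
    if "\<And>i. i \<in> {1..d} \<Longrightarrow> f i \<in> {0, 1}" for f :: "nat \<Rightarrow> nat"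
    using that
  proof (induction d)
    case (Suc d)
    have "(\<Sum>i=1..d. f i * 2 ^ (i - 1)) < 2 ^ d"
      using Suc by simp
    moreover have "f (Suc d) * 2 ^ d \<le> 2 ^ d"
      using Suc.prems[of "Suc d"] by auto
    ultimately have "(\<Sum>i=1..d. f i * 2 ^ (i - 1)) + f (Suc d) * 2 ^ d < 2 ^ d + 2 ^ d"
      by (rule add_less_le_mono)
    then show ?case by simp
  qed simp
  let ?s = "\<lambda>f :: nat \<Rightarrow> nat. \<Sum>i=1..d. f i * 2 ^ (i - 1)"
  have lt: "?s b < 2 ^ d" "?s c < 2 ^ d"
    by (rule bound, rule Suc.prems, simp)+
  have eq: "?s b + b (Suc d) * 2 ^ d = ?s c + c (Suc d) * 2 ^ d"
    using Suc.prems(3) by simp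
  have "b (Suc d) \<in> {0, 1}" "c (Suc d) \<in> {0, 1}"
    using Suc.prems(1)[of "Suc d"] Suc.prems(2)[of "Suc d"] by auto
  then have last: "b (Suc d) = c (Suc d)"
    using lt eq by auto
  then have "\<forall>i\<in>{1..d}. b i = c i"
    using eq Suc.prems(1,2) by (intro Suc.IH) auto
  with last show ?case
    by (auto simp: atLeastAtMostSuc_conv)
qed

definition kgreater :: "nat \<Rightarrow> nat \<Rightarrow> (nat \<Rightarrow> int) \<Rightarrow> (nat \<Rightarrow> int) \<Rightarrow> bool" where
  "kgreater d k x y \<longleftrightarrow> (\<forall>i\<in>{1..d}. (-1) ^ kbit k i * x i > (-1) ^ kbit k i * y i)"

text \<open>
  A space is given by a carrier \<open>X\<close> and a metric \<open>\<rho>\<close> on it, so that the same definitions apply to a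
  space and to its hyperspace.
\<close>

definition Zd_action ::
    "nat \<Rightarrow> 'a set \<Rightarrow> ('a \<Rightarrow> 'a \<Rightarrow> real) \<Rightarrow> ((nat \<Rightarrow> int) \<Rightarrow> 'a \<Rightarrow> 'a) \<Rightarrow> bool" where
  "Zd_action d X \<rho> T \<longleftrightarrow>
     continuous_map
       (prod_topology (discrete_topology (Zd d)) (Metric_space.mtopology X \<rho>))
       (Metric_space.mtopology X \<rho>) (\<lambda>(n, x). T n x) \<and>
     (\<forall>x\<in>X. T 0 x = x) \<and>
     (\<forall>n\<in>Zd d. \<forall>m\<in>Zd d. \<forall>x\<in>X. T (n + m) x = T n (T m x))"

definition hyperspace :: "'a set \<Rightarrow> ('a \<Rightarrow> 'a \<Rightarrow> real) \<Rightarrow> 'a set set" where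
  "hyperspace X \<rho> = {A. A \<noteq> {} \<and> closedin (Metric_space.mtopology X \<rho>) A}"

definition point_dist :: "('a \<Rightarrow> 'a \<Rightarrow> real) \<Rightarrow> 'a \<Rightarrow> 'a set \<Rightarrow> real" where
  "point_dist \<rho> x S = (INF s\<in>S. \<rho> x s)"

definition hausdorff_dist :: "('a \<Rightarrow> 'a \<Rightarrow> real) \<Rightarrow> 'a set \<Rightarrow> 'a set \<Rightarrow> real" where
  "hausdorff_dist \<rho> A B = max (SUP a\<in>A. point_dist \<rho> a B) (SUP b\<in>B. point_dist \<rho> b A)"

definition induced_action ::
    "((nat \<Rightarrow> int) \<Rightarrow> 'a \<Rightarrow> 'a) \<Rightarrow> (nat \<Rightarrow> int) \<Rightarrow> 'a set \<Rightarrow> 'a set" where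
  "induced_action T m A = T m ` A"

definition V_open :: "'a set \<Rightarrow> ('a \<Rightarrow> 'a \<Rightarrow> real) \<Rightarrow> real \<Rightarrow> ('a \<times> 'a) set" where
  "V_open X \<rho> \<epsilon> = {(x, y). x \<in> X \<and> y \<in> X \<and> \<rho> x y < \<epsilon>}"

definition V_closed :: "'a set \<Rightarrow> ('a \<Rightarrow> 'a \<Rightarrow> real) \<Rightarrow> real \<Rightarrow> ('a \<times> 'a) set" where
  "V_closed X \<rho> \<epsilon> = {(x, y). x \<in> X \<and> y \<in> X \<and> \<rho> x y \<le> \<epsilon>}"

definition kProx ::
    "nat \<Rightarrow> nat \<Rightarrow> 'a set \<Rightarrow> ('a \<Rightarrow> 'a \<Rightarrow> real) \<Rightarrow> ((nat \<Rightarrow> int) \<Rightarrow> 'a \<Rightarrow> 'a) \<Rightarrow> ('a \<times> 'a) set" where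
  "kProx d k X \<rho> T =
     (\<Inter>\<epsilon>\<in>{0<..}. \<Union>n\<in>{n \<in> Zd d. kgreater d k n 0}.
        map_prod (T (- n)) (T (- n)) ` V_open X \<rho> \<epsilon>)"

definition kAsym ::
    "nat \<Rightarrow> nat \<Rightarrow> 'a set \<Rightarrow> ('a \<Rightarrow> 'a \<Rightarrow> real) \<Rightarrow> ((nat \<Rightarrow> int) \<Rightarrow> 'a \<Rightarrow> 'a) \<Rightarrow> ('a \<times> 'a) set" where
  "kAsym d k X \<rho> T =
     (\<Inter>\<epsilon>\<in>{0<..}. \<Union>n\<in>{n \<in> Zd d. kgreater d k n 0}.
        map_prod (T (- n)) (T (- n)) `
          (\<Inter>m\<in>{m \<in> Zd d. kgreater d k m 0}.
             map_prod (T (- m)) (T (- m)) ` V_closed X \<rho> \<epsilon>))"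

definition kLiYorke_pair ::
    "nat \<Rightarrow> nat \<Rightarrow> 'a set \<Rightarrow> ('a \<Rightarrow> 'a \<Rightarrow> real) \<Rightarrow> ((nat \<Rightarrow> int) \<Rightarrow> 'a \<Rightarrow> 'a) \<Rightarrow> 'a \<Rightarrow> 'a \<Rightarrow> bool" where
  "kLiYorke_pair d k X \<rho> T x y \<longleftrightarrow> (x, y) \<in> kProx d k X \<rho> T - kAsym d k X \<rho> T"

definition kscrambled ::
    "nat \<Rightarrow> nat \<Rightarrow> 'a set \<Rightarrow> ('a \<Rightarrow> 'a \<Rightarrow> real) \<Rightarrow> ((nat \<Rightarrow> int) \<Rightarrow> 'a \<Rightarrow> 'a) \<Rightarrow> 'a set \<Rightarrow> bool" where
  "kscrambled d k X \<rho> T S \<longleftrightarrow>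
     S \<subseteq> X \<and> (\<forall>x\<in>S. \<forall>y\<in>S. x \<noteq> y \<longrightarrow> kLiYorke_pair d k X \<rho> T x y)"

definition kLiYorke_chaotic ::
    "nat \<Rightarrow> nat \<Rightarrow> 'a set \<Rightarrow> ('a \<Rightarrow> 'a \<Rightarrow> real) \<Rightarrow> ((nat \<Rightarrow> int) \<Rightarrow> 'a \<Rightarrow> 'a) \<Rightarrow> bool" where
  "kLiYorke_chaotic d k X \<rho> T \<longleftrightarrow> (\<exists>S. uncountable S \<and> kscrambled d k X \<rho> T S)"

end

theory Submission
  imports Defs
begin

text \<open>
  The map \<open>x \<mapsto> {x}\<close> embeds \<open>X\<close> isometrically into its hyperspace and carries \<open>T\<close> to the
  induced action; it therefore carries a scrambled set to a scrambled set of the same cardinality.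
  Proximality transfers at once. Asymptoticity has to be reflected, and since both relations are
  defined through images of neighbourhoods of the diagonal, the witnesses for an asymptotic pair of
  singletons are a priori arbitrary closed sets. They are singletons themselves: each \<open>T\<^sup>n\<close> is
  injective on \<open>X\<close>, so only a singleton can be mapped onto a singleton.
\<close>

lemma uminus_Zd: "n \<in> Zd d \<Longrightarrow> - n \<in> Zd d"
  by (simp add: Zd_def)

text \<open>
  An intersection over all \<open>m >\<^sup>k 0\<close> says something about its members only because the orthant is
  inhabited.
\<close>

lemma kgreater_0_nonempty: "\<exists>m \<in> Zd d. kgreater d k m 0"
proof -
  define m :: "nat \<Rightarrow> int" where "m i = (if i \<in> {1..d} then (-1) ^ kbit k i else 0)" for i
  have "m \<in> Zd d"
    by (auto simp: Zd_def m_def)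
  moreover have "kgreater d k m 0"
    by (auto simp: kgreater_def m_def power_add [symmetric] mult_2 [symmetric])
  ultimately show ?thesis by blast
qed

lemma Zd_action_closed:
  assumes "Metric_space X \<rho>" "Zd_action d X \<rho> T" "n \<in> Zd d" "x \<in> X"
  shows "T n x \<in> X"
proof -
  interpret Metric_space X \<rho> by fact
  show ?thesis
    using assms(2-4) by (auto simp: Zd_action_def continuous_map_def Pi_iff)
qed

lemma Zd_action_inj_on:
  assumes "Zd_action d X \<rho> T" "n \<in> Zd d"
  shows "inj_on (T n) X"
proof (rule inj_on_inverseI)
  fix x assume "x \<in> X"
  then have "T (- n) (T n x) = T (- n + n) x"
    using assms uminus_Zd unfolding Zd_action_def by metis
  then show "T (- n) (T n x) = x"
    using assms \<open>x \<in> X\<close> by (simp add: Zd_action_def)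
qed

lemma image_eq_singletonE:
  assumes "inj_on f X" "A \<subseteq> X" "f ` A = {y}"
  obtains a where "a \<in> X" "A = {a}" "f a = y"
proof -
  obtain a where a: "a \<in> A" "f a = y"
    using assms(3) by blast
  have "b = a" if "b \<in> A" for b
  proof (rule inj_onD [OF assms(1)])
    show "f b = f a"
      using that a assms(3) by blast
  qed (use that a assms(2) in auto)
  then have "A = {a}"
    using a by blast
  with a assms(2) show thesis
    by (intro that [of a]) simp_all
qed

lemma hyperspace_subset:
  assumes "Metric_space X \<rho>" "A \<in> hyperspace X \<rho>"
  shows "A \<subseteq> X"
  using assms closedin_subset [of "Metric_space.mtopology X \<rho>" A]
  by (simp add: hyperspace_def Metric_space.topspace_mtopology)

lemma singleton_in_hyperspace:
  assumes "Metric_space X \<rho>" "x \<in> X"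
  shows "{x} \<in> hyperspace X \<rho>"
proof -
  interpret Metric_space X \<rho> by fact
  show ?thesis
    using assms(2) by (simp add: hyperspace_def closedin_Hausdorff_singleton Hausdorff_space_mtopology)
qed

lemma hausdorff_dist_singletons:
  assumes "Metric_space X \<rho>"
  shows "hausdorff_dist \<rho> {x} {y} = \<rho> x y"
  using Metric_space.commute [OF assms, of x y] by (simp add: hausdorff_dist_def point_dist_def)

lemma kProx_singletons:
  assumes X: "Metric_space X \<rho>" and xy: "(x, y) \<in> kProx d k X \<rho> T"
  shows "({x}, {y}) \<in> kProx d k (hyperspace X \<rho>) (hausdorff_dist \<rho>) (induced_action T)"
  unfolding kProx_def
proof (rule INT_I)
  fix \<epsilon> :: real assume "\<epsilon> \<in> {0<..}"
  from INT_D [OF xy [unfolded kProx_def] this]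
  obtain n u v where n: "n \<in> Zd d" "kgreater d k n 0"
    and uv: "u \<in> X" "v \<in> X" "\<rho> u v < \<epsilon>" "x = T (- n) u" "y = T (- n) v"
    by (auto simp: V_open_def)
  have "({u}, {v}) \<in> V_open (hyperspace X \<rho>) (hausdorff_dist \<rho>) \<epsilon>"
    using uv by (simp add: V_open_def singleton_in_hyperspace [OF X] hausdorff_dist_singletons [OF X])
  moreover have "({x}, {y}) = map_prod (induced_action T (- n)) (induced_action T (- n)) ({u}, {v})"
    using uv by (simp add: induced_action_def)
  ultimately show "({x}, {y}) \<in> (\<Union>n\<in>{n \<in> Zd d. kgreater d k n 0}.
      map_prod (induced_action T (- n)) (induced_action T (- n)) `
        V_open (hyperspace X \<rho>) (hausdorff_dist \<rho>) \<epsilon>)"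
    using n by blast
qed

text \<open>
  Pulling \<open>({x}, {y})\<close> back along \<open>T\<^sup>-\<^sup>n\<close> and then along every \<open>T\<^sup>-\<^sup>m\<close> stays within pairs of
  singletons by injectivity, so the witnesses in the hyperspace descend to witnesses in \<open>X\<close>.
\<close>

lemma kAsym_singletonsD:
  assumes X: "Metric_space X \<rho>" and T: "Zd_action d X \<rho> T"
    and xy: "({x}, {y}) \<in> kAsym d k (hyperspace X \<rho>) (hausdorff_dist \<rho>) (induced_action T)"
  shows "(x, y) \<in> kAsym d k X \<rho> T"
  unfolding kAsym_def
proof (rule INT_I)
  let ?P = "{n \<in> Zd d. kgreater d k n 0}"
  have inj: "inj_on (T (- n)) X" if "n \<in> ?P" for n
    using that by (simp add: Zd_action_inj_on [OF T] uminus_Zd)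
  fix \<epsilon> :: real assume "\<epsilon> \<in> {0<..}"
  from INT_D [OF xy [unfolded kAsym_def] this]
  obtain n p where n: "n \<in> ?P"
    and p: "({x}, {y}) = map_prod (induced_action T (- n)) (induced_action T (- n)) p"
    and p_pull: "\<forall>m\<in>?P. p \<in> map_prod (induced_action T (- m)) (induced_action T (- m)) `
        V_closed (hyperspace X \<rho>) (hausdorff_dist \<rho>) \<epsilon>"
    by (elim UN_E imageE) blast
  obtain A B where AB_eq: "p = (A, B)"
    by (rule prod.exhaust)
  have AB: "T (- n) ` A = {x}" "T (- n) ` B = {y}"
    using p by (simp_all add: AB_eq induced_action_def)
  have pull: "\<exists>C D. C \<in> hyperspace X \<rho> \<and> D \<in> hyperspace X \<rho>
        \<and> hausdorff_dist \<rho> C D \<le> \<epsilon> \<and> A = T (- m) ` C \<and> B = T (- m) ` D" if "m \<in> ?P" for m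
    using bspec [OF p_pull that] by (auto simp: AB_eq V_closed_def induced_action_def) metis
  have sub: "A \<subseteq> X" "B \<subseteq> X"
  proof -
    obtain m where m: "m \<in> ?P"
      using kgreater_0_nonempty by blast
    have "T (- m) ` C \<subseteq> X" if "C \<in> hyperspace X \<rho>" for C
      using m hyperspace_subset [OF X that] Zd_action_closed [OF X T] uminus_Zd by blast
    then show "A \<subseteq> X" "B \<subseteq> X"
      using pull [OF m] by blast+
  qed
  obtain a where a: "a \<in> X" "A = {a}" "T (- n) a = x"
    using image_eq_singletonE [OF inj [OF n] sub(1) AB(1)] .
  obtain b where b: "b \<in> X" "B = {b}" "T (- n) b = y"
    using image_eq_singletonE [OF inj [OF n] sub(2) AB(2)] .
  have "(a, b) \<in> map_prod (T (- m)) (T (- m)) ` V_closed X \<rho> \<epsilon>" if m: "m \<in> ?P" for m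
  proof -
    obtain C D where CD: "C \<in> hyperspace X \<rho>" "D \<in> hyperspace X \<rho>"
      "hausdorff_dist \<rho> C D \<le> \<epsilon>" "T (- m) ` C = {a}" "T (- m) ` D = {b}"
      using pull [OF m] unfolding a(2) b(2) by auto
    obtain u where u: "u \<in> X" "C = {u}" "T (- m) u = a"
      using image_eq_singletonE [OF inj [OF m] hyperspace_subset [OF X CD(1)] CD(4)] .
    obtain v where v: "v \<in> X" "D = {v}" "T (- m) v = b"
      using image_eq_singletonE [OF inj [OF m] hyperspace_subset [OF X CD(2)] CD(5)] .
    have "(u, v) \<in> V_closed X \<rho> \<epsilon>"
      using u v CD(3) by (simp add: V_closed_def hausdorff_dist_singletons [OF X])
    then show ?thesis
      using u v by force
  qed
  then have "(a, b) \<in> (\<Inter>m\<in>?P. map_prod (T (- m)) (T (- m)) ` V_closed X \<rho> \<epsilon>)"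
    by (rule INT_I)
  moreover have "(x, y) = map_prod (T (- n)) (T (- n)) (a, b)"
    using a b by simp
  ultimately show "(x, y) \<in> (\<Union>n\<in>?P. map_prod (T (- n)) (T (- n)) `
      (\<Inter>m\<in>?P. map_prod (T (- m)) (T (- m)) ` V_closed X \<rho> \<epsilon>))"
    using n by (intro UN_I [OF n] image_eqI)
qed

lemma kscrambled_singletons:
  assumes X: "Metric_space X \<rho>" and T: "Zd_action d X \<rho> T" and S: "kscrambled d k X \<rho> T S"
  shows "kscrambled d k (hyperspace X \<rho>) (hausdorff_dist \<rho>) (induced_action T) ((\<lambda>x. {x}) ` S)"
proof -
  have "kLiYorke_pair d k (hyperspace X \<rho>) (hausdorff_dist \<rho>) (induced_action T) {x} {y}"
    if "kLiYorke_pair d k X \<rho> T x y" for x y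
    using that kProx_singletons [OF X, of x y d k T] kAsym_singletonsD [OF X T, of x y k]
    by (auto simp: kLiYorke_pair_def)
  then show ?thesis
    using S singleton_in_hyperspace [OF X] by (auto simp: kscrambled_def subset_iff)
qed

theorem theorem3p8:
  fixes X :: "'a set" and \<rho> :: "'a \<Rightarrow> 'a \<Rightarrow> real"
    and d k :: nat and T :: "(nat \<Rightarrow> int) \<Rightarrow> 'a \<Rightarrow> 'a"
  assumes "Metric_space X \<rho>"
    and "compact_space (Metric_space.mtopology X \<rho>)"
    and "d \<ge> 1"
    and "Zd_action d X \<rho> T"
    and "k \<in> {1..2 ^ d}"
    and "kLiYorke_chaotic d k X \<rho> T"
  shows "kLiYorke_chaotic d k (hyperspace X \<rho>) (hausdorff_dist \<rho>) (induced_action T)"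
proof -
  obtain S where S: "uncountable S" "kscrambled d k X \<rho> T S"
    using assms(6) by (auto simp: kLiYorke_chaotic_def)
  have "uncountable ((\<lambda>x. {x}) ` S)"
    using S(1) countable_image_inj_on [of "\<lambda>x. {x}" S] by (auto simp: inj_on_def)
  then show ?thesis
    using kscrambled_singletons [OF assms(1,4) S(2)] by (auto simp: kLiYorke_chaotic_def)
qed

end
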